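(* Let $X$ be a vector space over $\mathbb{R}$, let $\Omega\subseteq X$ and $f\colon\Omega\to\overline{\mathbb{R}}$. Let the set $\Omega^{\circ}\subseteq\Omega$ be closed with respect to segments in $\Omega$, and let the function $f^{\circ}\colon\Omega^{\circ}\to\overline{\mathbb{R}}$ be defined by $f^\circ(x)=f(x)$ for $x\in\Omega^{\circ}\setminus\partial^s_{\Omega}\Omega^{\circ}$ and $f^{\circ}(x)=\mathcal{B}_{f,\Omega}(x)$ for $x\in\partial^s_{\Omega}\Omega^{\circ}$. Then $\mathcal{B}_{f,\Omega}|_{\Omega^{\circ}}=\mathcal{B}_{f^{\circ},\Omega^{\circ}}$.
   Context: $\overline{\mathbb{R}}=\mathbb{R}\cup\{-\infty,+\infty\}$. $[a,b]=\{(1-t)a+tb:0\le t\le1\}$ and $(a,b)=\{(1-t)a+tb:0<t<1\}$. An $\overline{\mathbb{R}}$-valued function $B$ on a convex set is concave if its subgraph $\{(z,t):t\in\mathbb{R},\,t\le B(z)\}$ is convex. A function $B\colon\Omega\to\overline{\mathbb{R}}$, $\Omega\subseteq X$, is locally concave if its restriction to every segment contained in $\Omega$ is concave. The minimal locally concave function on $\Omega$ with obstacle $f\colon\Omega\to\overline{\mathbb{R}}$ is $\mathcal{B}_{f,\Omega}(x)=\inf\{B(x): B\colon\Omega\to\overline{\mathbb{R}}\text{ locally concave},\ B\ge f\}$, $x\in\Omega$. For $V\subseteq U\subseteq X$: $V$ is closed with respect to segments in $U$ if for all $x,y\in U$ with $(x,y)\subseteq V$ one has $x,y\in V$. For $a\neq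 b$ in $X$, the boundary of $V$ along $(a,b)$, denoted $\partial_a^bV$, is the set of points of $V\cap(a,b)$ that lie in the boundary of $V\cap(a,b)$ in the standard topology of the line through $a$ and $b$. The inner boundary of $V$ with respect to segments in $U$ is $\partial_U^sV=\bigcup_{[a,b]\subseteq U}\partial_a^bV$. *)

theory Defs
  imports "HOL-Analysis.Analysis"
begin

text \<open>
  A function on a subset \<open>S\<close> of a real vector space is a total function whose values outside
  \<open>S\<close> are ignored.
\<close>

definition ereal_concave_on :: "'a::real_vector set \<Rightarrow> ('a \<Rightarrow> ereal) \<Rightarrow> bool" where
  "ereal_concave_on S B \<longleftrightarrow> convex {(z, t::real). z \<in> S \<and> ereal t \<le> B z}"

definition locally_concave_on :: "'a::real_vector set \<Rightarrow> ('a \<Rightarrow> ereal) \<Rightarrow> bool" where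
  "locally_concave_on \<Omega> B \<longleftrightarrow>
     (\<forall>a b. closed_segment a b \<subseteq> \<Omega> \<longrightarrow> ereal_concave_on (closed_segment a b) B)"

text \<open>Only meaningful at points \<open>x \<in> \<Omega>\<close>.\<close>
definition min_locally_concave ::
    "('a::real_vector \<Rightarrow> ereal) \<Rightarrow> 'a set \<Rightarrow> 'a \<Rightarrow> ereal" where
  "min_locally_concave f \<Omega> x =
     Inf {B x | B. locally_concave_on \<Omega> B \<and> (\<forall>y\<in>\<Omega>. f y \<le> B y)}"

definition line_point :: "'a::real_vector \<Rightarrow> 'a \<Rightarrow> real \<Rightarrow> 'a" where
  "line_point a b t = (1 - t) *\<^sub>R a + t *\<^sub>R b"

text \<open>
  Unlike \<^const>\<open>open_segment\<close>, which is empty when the end points coincide, the open segment from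
  \<open>a\<close> to \<open>a\<close> is \<open>{a}\<close>. This matters in \<open>closed_wrt_segments\<close>, where \<open>x = y\<close> is allowed.
\<close>
definition open_seg :: "'a::real_vector \<Rightarrow> 'a \<Rightarrow> 'a set" where
  "open_seg a b = line_point a b ` {0<..<1}"

definition closed_wrt_segments :: "'a::real_vector set \<Rightarrow> 'a set \<Rightarrow> bool" where
  "closed_wrt_segments U V \<longleftrightarrow>
     (\<forall>x\<in>U. \<forall>y\<in>U. open_seg x y \<subseteq> V \<longrightarrow> x \<in> V \<and> y \<in> V)"

text \<open>
  The ambient space carries no topology. For \<open>a \<noteq> b\<close>, the line through \<open>a\<close> and \<open>b\<close> gets the
  topology of the reals, transported along the affine bijection \<^term>\<open>line_point a b\<close>.
\<close>
definition line_topology :: "'a::real_vector \<Rightarrow> 'a \<Rightarrow> 'a topology" where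
  "line_topology a b =
     topology (\<lambda>U. U \<subseteq> range (line_point a b) \<and> open (line_point a b -` U))"

lemma openin_line_topology:
  "openin (line_topology a b) U \<longleftrightarrow>
     U \<subseteq> range (line_point a b) \<and> open (line_point a b -` U)"
proof -
  have "istopology (\<lambda>U. U \<subseteq> range (line_point a b) \<and> open (line_point a b -` U))"
    unfolding istopology_def by (auto simp: vimage_Int vimage_Union)
  then show ?thesis
    unfolding line_topology_def by (simp add: topology_inverse')
qed

definition boundary_along :: "'a::real_vector \<Rightarrow> 'a \<Rightarrow> 'a set \<Rightarrow> 'a set" where
  "boundary_along a b V =
     (V \<inter> open_seg a b) \<inter> (line_topology a b frontier_of (V \<inter> open_seg a b))"

definition inner_boundary :: "'a::real_vector set \<Rightarrow> 'a set \<Rightarrow> 'a set" where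
  "inner_boundary U V =
     \<Union>{boundary_along a b V | a b. a \<noteq> b \<and> closed_segment a b \<subseteq> U}"

end

theory Submission
  imports Defs
begin

text \<open>
  The function \<open>B = min_locally_concave f \<Omega>\<close> is itself locally concave, because the subgraph of an
  infimum is the intersection of the subgraphs (\<open>locally_concave_on_min_locally_concave\<close>).
  Restricted to \<open>\<Omega>'\<close> it is a locally concave majorant of \<open>f'\<close>, which gives \<open>\<ge>\<close>.

  For \<open>\<le>\<close>, take a locally concave majorant \<open>G\<close> of \<open>f'\<close> on \<open>\<Omega>'\<close> and replace it by \<open>min G B\<close>, which
  agrees with \<open>B\<close> on the inner boundary of \<open>\<Omega>'\<close>. It has to be seen that extending this minimum by
  \<open>B\<close> to the rest of \<open>\<Omega>\<close> gives a locally concave function; the extension then competes in the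
  infimum defining \<open>B\<close>. This is the gluing lemma \<open>locally_concave_on_glue\<close>. Its content is
  one-dimensional: given a segment in \<open>\<Omega>\<close> and an affine function \<open>l\<close> lying below the extension at
  both ends, concavity of \<open>B\<close> puts \<open>l\<close> below \<open>B\<close> on the whole segment. So \<open>l\<close> is below the extension
  wherever the extension equals \<open>B\<close>, and a point where it does not is interior to the trace of
  \<open>\<Omega>'\<close> on the segment. Since \<open>\<Omega>'\<close> is closed with respect to segments, the component of the trace
  containing this point is a closed interval whose ends are ends of the segment or inner boundary
  points. At both ends of this interval \<open>l\<close> is below the extension, and concavity of \<open>min G B\<close>
  on the interval carries this over to the point.
\<close>

lemma line_point_line_point:
  "line_point (line_point x y c) (line_point x y d) k = line_point x y (line_point c d k)"
  by (simp add: line_point_def algebra_simps)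

lemma line_point_in_closed_segment:
  "0 \<le> t \<Longrightarrow> t \<le> 1 \<Longrightarrow> line_point a b t \<in> closed_segment a b"
  by (auto simp: line_point_def closed_segment_def)

lemma closed_segment_line_point:
  "closed_segment (line_point x y c) (line_point x y d) = line_point x y ` closed_segment c d"
proof -
  have *: "closed_segment a b = line_point a b ` {0..1}" for a b :: "'c::real_vector"
    by (auto simp: closed_segment_def line_point_def)
  show ?thesis
    unfolding * image_image line_point_line_point ..
qed

lemma open_seg_line_point:
  assumes "c < d"
  shows "open_seg (line_point x y c) (line_point x y d) = line_point x y ` {c<..<d}"
proof -
  have "open_seg c d = {c<..<d}"
  proof -
    have "open_segment c d = open_seg c d"
      using assms by (simp add: open_seg_def line_point_def open_segment_image_interval)
    then show ?thesis
      using assms by (simp add: open_segment_eq_real_ivl)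
  qed
  moreover have "open_seg (line_point x y c) (line_point x y d) = line_point x y ` open_seg c d"
    unfolding open_seg_def image_image line_point_line_point ..
  ultimately show ?thesis by simp
qed


section \<open>Locally concave functions\<close>

text \<open>
  Concavity as an inequality on chords. Only real values below the function occur, so that no
  convention for \<open>\<infinity> - \<infinity>\<close> is involved.
\<close>
lemma locally_concave_on_iff:
  "locally_concave_on \<Omega> B \<longleftrightarrow>
     (\<forall>x y \<alpha> \<beta> u. closed_segment x y \<subseteq> \<Omega> \<longrightarrow> ereal \<alpha> \<le> B x \<longrightarrow> ereal \<beta> \<le> B y \<longrightarrow>
        0 \<le> u \<longrightarrow> u \<le> 1 \<longrightarrow> ereal (line_point \<alpha> \<beta> u) \<le> B (line_point x y u))"
  (is "?L \<longleftrightarrow> ?R")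
proof
  assume L: ?L
  show ?R
  proof (intro allI impI)
    fix x y \<alpha> \<beta> and u :: real
    assume xy: "closed_segment x y \<subseteq> \<Omega>" "ereal \<alpha> \<le> B x" "ereal \<beta> \<le> B y" and u: "0 \<le> u" "u \<le> 1"
    let ?S = "{(z, t::real). z \<in> closed_segment x y \<and> ereal t \<le> B z}"
    have "convex ?S"
      using L xy(1) by (auto simp: locally_concave_on_def ereal_concave_on_def)
    moreover have "(x, \<alpha>) \<in> ?S" "(y, \<beta>) \<in> ?S"
      using xy by auto
    ultimately have "(1 - u) *\<^sub>R (x, \<alpha>) + u *\<^sub>R (y, \<beta>) \<in> ?S"
      using u by (intro convexD) auto
    then show "ereal (line_point \<alpha> \<beta> u) \<le> B (line_point x y u)"
      by (simp add: line_point_def)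
  qed
next
  assume R: ?R
  show ?L
    unfolding locally_concave_on_def ereal_concave_on_def
  proof (intro allI impI)
    fix a b assume ab: "closed_segment a b \<subseteq> \<Omega>"
    show "convex {(z, t::real). z \<in> closed_segment a b \<and> ereal t \<le> B z}" (is "convex ?S")
      unfolding convex_alt
    proof (intro ballI allI impI)
      fix p q and u :: real
      assume pq: "p \<in> ?S" "q \<in> ?S" and "0 \<le> u \<and> u \<le> 1"
      moreover obtain x \<alpha> y \<beta> where p: "p = (x, \<alpha>)" "q = (y, \<beta>)"
        by (cases p, cases q)
      ultimately have x: "x \<in> closed_segment a b" "ereal \<alpha> \<le> B x"
        and y: "y \<in> closed_segment a b" "ereal \<beta> \<le> B y" and u: "0 \<le> u" "u \<le> 1"
        by auto
      have sub: "closed_segment x y \<subseteq> closed_segment a b"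
        using x(1) y(1) by (simp add: closed_segment_subset)
      then have "ereal (line_point \<alpha> \<beta> u) \<le> B (line_point x y u)"
        using R x y u ab by blast
      moreover have "line_point x y u \<in> closed_segment a b"
        using sub line_point_in_closed_segment[OF u] by blast
      ultimately show "(1 - u) *\<^sub>R p + u *\<^sub>R q \<in> ?S"
        by (simp add: p line_point_def)
    qed
  qed
qed

lemma locally_concave_onD:
  assumes "locally_concave_on \<Omega> B" "closed_segment x y \<subseteq> \<Omega>" "ereal \<alpha> \<le> B x" "ereal \<beta> \<le> B y"
    and "0 \<le> u" "u \<le> 1"
  shows "ereal (line_point \<alpha> \<beta> u) \<le> B (line_point x y u)"
  using assms unfolding locally_concave_on_iff by blast

lemma locally_concave_on_subset:
  "locally_concave_on \<Omega> B \<Longrightarrow> S \<subseteq> \<Omega> \<Longrightarrow> locally_concave_on S B"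
  by (auto simp: locally_concave_on_def)

lemma locally_concave_on_min:
  assumes "locally_concave_on \<Omega> B" "locally_concave_on \<Omega> C"
  shows "locally_concave_on \<Omega> (\<lambda>x. min (B x) (C x))"
  unfolding locally_concave_on_iff
  by (auto intro: locally_concave_onD[OF assms(1)] locally_concave_onD[OF assms(2)])

lemma locally_concave_on_min_locally_concave:
  "locally_concave_on \<Omega> (min_locally_concave f \<Omega>)"
  unfolding locally_concave_on_iff
proof (intro allI impI)
  fix x y \<alpha> \<beta> and u :: real
  assume xy: "closed_segment x y \<subseteq> \<Omega>" "ereal \<alpha> \<le> min_locally_concave f \<Omega> x"
      "ereal \<beta> \<le> min_locally_concave f \<Omega> y" and u: "0 \<le> u" "u \<le> 1"
  show "ereal (line_point \<alpha> \<beta> u) \<le> min_locally_concave f \<Omega> (line_point x y u)"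
    unfolding min_locally_concave_def
  proof (rule Inf_greatest, clarify)
    fix B assume B: "locally_concave_on \<Omega> B" "\<forall>y\<in>\<Omega>. f y \<le> B y"
    then have "min_locally_concave f \<Omega> z \<le> B z" for z
      unfolding min_locally_concave_def by (intro Inf_lower) blast
    then show "ereal (line_point \<alpha> \<beta> u) \<le> B (line_point x y u)"
      using locally_concave_onD[OF B(1) xy(1) _ _ u] xy(2,3) by (meson order_trans)
  qed
qed

lemma min_locally_concave_ge:
  "x \<in> \<Omega> \<Longrightarrow> f x \<le> min_locally_concave f \<Omega> x"
  unfolding min_locally_concave_def by (rule Inf_greatest) auto

lemma min_locally_concave_le:
  "locally_concave_on \<Omega> B \<Longrightarrow> (\<And>y. y \<in> \<Omega> \<Longrightarrow> f y \<le> B y) \<Longrightarrow> min_locally_concave f \<Omega> x \<le> B x"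
  unfolding min_locally_concave_def by (rule Inf_lower) blast


section \<open>Traces on lines of sets closed with respect to segments\<close>

text \<open>
  The point \<open>c\<close> is the left end of the component of \<open>u\<close> in the part of \<open>P\<close> to the right of \<open>a\<close>:
  the closedness hypothesis puts \<open>c\<close> into \<open>P\<close>, and if \<open>c\<close> were interior to \<open>P\<close> and not stopped
  by \<open>a\<close>, the component would reach further.
\<close>
lemma left_end_of_component:
  fixes P :: "real set"
  assumes "a < u" "u \<in> interior P"
    and closed: "\<And>s. a \<le> s \<Longrightarrow> s < u \<Longrightarrow> {s<..<u} \<subseteq> P \<Longrightarrow> s \<in> P"
  obtains c where "a \<le> c" "c < u" "{c..u} \<subseteq> P" "c = a \<or> c \<notin> interior P"
proof -
  define C where "C = {x. a \<le> x \<and> x \<le> u \<and> {x..u} \<subseteq> P}"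
  define c where "c = Inf C"
  have ball: "\<exists>s\<in>C. s < r" if "a < r" "r \<le> u" "{r..u} \<subseteq> P" and r: "r \<in> interior P" for r
  proof -
    obtain e where e: "e > 0" "ball r e \<subseteq> P"
      using r by (auto simp: mem_interior)
    define s where "s = max a (r - e / 2)"
    have "a \<le> s" "s < r"
      using that e(1) by (auto simp: s_def)
    moreover have "{s..r} \<subseteq> ball r e"
      using e(1) by (auto simp: s_def dist_real_def)
    then have "{s..u} \<subseteq> P"
      using e(2) that(3) by (meson atLeastAtMost_iff linear subset_iff)
    ultimately show ?thesis
      using that by (auto simp: C_def intro!: bexI[of _ s])
  qed
  have bdd: "bdd_below C"
    by (auto simp: C_def intro!: bdd_belowI[of _ a])
  have uP: "u \<in> P"
    using assms(2) interior_subset by blast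
  then obtain s where s: "s \<in> C" "s < u"
    using ball[of u] assms(1,2) by auto
  have "a \<le> c"
    unfolding c_def using s(1) by (intro cInf_greatest) (auto simp: C_def)
  have "c < u"
    using cInf_lower[OF s(1) bdd] s(2) by (simp add: c_def)
  have sub: "{c<..u} \<subseteq> P"
  proof
    fix r assume r: "r \<in> {c<..u}"
    then obtain s where "s \<in> C" "s < r"
      using cInf_lessD[of C r] s(1) by (auto simp: c_def)
    then show "r \<in> P"
      using r by (auto simp: C_def)
  qed
  then have "c \<in> P"
    using closed[OF \<open>a \<le> c\<close> \<open>c < u\<close>] by force
  with sub have cu: "{c..u} \<subseteq> P"
    by (metis atLeastAtMost_iff greaterThanAtMost_iff order_le_less subset_iff)
  have "c = a \<or> c \<notin> interior P"
  proof (rule ccontr)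
    assume "\<not> ?thesis"
    then obtain s where "s \<in> C" "s < c"
      using ball[of c] \<open>a \<le> c\<close> \<open>c < u\<close> cu by auto
    then show False
      using cInf_lower[of s C] bdd by (simp add: c_def)
  qed
  then show thesis
    using that \<open>a \<le> c\<close> \<open>c < u\<close> cu by blast
qed

lemma right_end_of_component:
  fixes P :: "real set"
  assumes "u < b" "u \<in> interior P"
    and closed: "\<And>t. u < t \<Longrightarrow> t \<le> b \<Longrightarrow> {u<..<t} \<subseteq> P \<Longrightarrow> t \<in> P"
  obtains d where "u < d" "d \<le> b" "{u..d} \<subseteq> P" "d = b \<or> d \<notin> interior P"
proof -
  have mem: "x \<in> uminus ` A \<longleftrightarrow> - x \<in> A" for x and A :: "real set"
    by force
  have int: "interior (uminus ` P) = uminus ` interior P"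
    by (rule interior_negations)
  have cl: "s \<in> uminus ` P" if "- b \<le> s" "s < - u" "{s<..<- u} \<subseteq> uminus ` P" for s
  proof -
    have "{u<..<- s} \<subseteq> P"
      proof
      fix t assume "t \<in> {u<..<- s}"
      then have "- t \<in> {s<..<- u}"
        by simp
      then have "- t \<in> uminus ` P"
        using that(3) by blast
      then show "t \<in> P"
        by (simp only: mem minus_minus)
    qed
    then show ?thesis
      using closed[of "- s"] that by (simp add: mem)
  qed
  obtain c where c: "- b \<le> c" "c < - u" "{c..- u} \<subseteq> uminus ` P" "c = - b \<or> c \<notin> interior (uminus ` P)"
    using left_end_of_component[of "- b" "- u" "uminus ` P"] assms(1,2) cl
    by (auto simp: int mem)
  have "{u..- c} \<subseteq> P"
    proof
    fix t assume "t \<in> {u..- c}"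
    then have "- t \<in> {c..- u}"
      by simp
    then have "- t \<in> uminus ` P"
      using c(3) by blast
    then show "t \<in> P"
      by (simp only: mem minus_minus)
  qed
  then show thesis
    using that[of "- c"] c by (auto simp: int mem)
qed

text \<open>
  The part of the inner boundary on a segment is found by looking at the parameter line only: the
  topology of the line is that of the parameter.
\<close>
lemma line_point_in_inner_boundary:
  assumes "x \<noteq> y" "closed_segment x y \<subseteq> U" "0 < c" "c < 1"
    and "line_point x y c \<in> V" "c \<notin> interior (line_point x y -` V)"
  shows "line_point x y c \<in> inner_boundary U V"
proof -
  let ?p = "line_point x y c" and ?T = "line_topology x y" and ?S = "V \<inter> open_seg x y"
  have S: "?p \<in> ?S"
    using assms(3-5) by (auto simp: open_seg_def)
  have "line_point x y -` range (line_point x y) = UNIV"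
    by auto
  then have "openin ?T (range (line_point x y))"
    by (simp add: openin_line_topology)
  then have "?p \<in> topspace ?T"
    using openin_subset by blast
  then have "?p \<in> ?T closure_of ?S"
    using S closure_of_subset_Int[of ?T ?S] by blast
  moreover have "?p \<notin> ?T interior_of ?S"
  proof
    assume "?p \<in> ?T interior_of ?S"
    then obtain W where "openin ?T W" "?p \<in> W" "W \<subseteq> ?S"
      by (auto simp: interior_of_def)
    then have "c \<in> interior (line_point x y -` V)"
      by (intro interiorI[of "line_point x y -` W"]) (auto simp: openin_line_topology)
    then show False
      using assms(6) by blast
  qed
  ultimately have "?p \<in> boundary_along x y V"
    using S by (simp add: boundary_along_def frontier_of_def)
  then show ?thesis
    using assms(1,2) unfolding inner_boundary_def by blast
qed

lemma inner_boundary_subset: "inner_boundary U V \<subseteq> V"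
  by (auto simp: inner_boundary_def boundary_along_def)


section \<open>Gluing\<close>

text \<open>
  The glued function lies below \<open>H\<close>, so an affine function below it at both ends of a segment is
  below \<open>H\<close> throughout, in particular at the inner boundary points, where \<open>G = H\<close>. These bound the
  subsegments inside \<open>V\<close>, on which concavity of \<open>G\<close> takes over.
\<close>
lemma locally_concave_on_glue:
  assumes V: "closed_wrt_segments U V"
    and H: "locally_concave_on U H" and G: "locally_concave_on V G"
    and le: "\<And>x. x \<in> V \<Longrightarrow> G x \<le> H x"
    and eq: "\<And>x. x \<in> inner_boundary U V \<Longrightarrow> G x = H x"
  shows "locally_concave_on U (\<lambda>x. if x \<in> V then G x else H x)"
    (is "locally_concave_on U ?F")
  unfolding locally_concave_on_iff
proof (intro allI impI)
  fix x y \<alpha> \<beta> and u :: real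
  assume xy: "closed_segment x y \<subseteq> U" and \<alpha>: "ereal \<alpha> \<le> ?F x" and \<beta>: "ereal \<beta> \<le> ?F y"
    and u: "0 \<le> u" "u \<le> 1"
  define P where "P = line_point x y -` V"
  have FH: "?F z \<le> H z" for z
    using le by auto
  have below_H: "ereal (line_point \<alpha> \<beta> r) \<le> H (line_point x y r)" if "0 \<le> r" "r \<le> 1" for r
    using locally_concave_onD[OF H xy _ _ that] \<alpha> \<beta> FH order_trans by blast
  show "ereal (line_point \<alpha> \<beta> u) \<le> ?F (line_point x y u)"
  proof (cases "x = y")
    case True
    have "line_point \<alpha> \<beta> u \<le> max \<alpha> \<beta>"
      using u convex_bound_le[of \<alpha> "max \<alpha> \<beta>" \<beta> "1 - u" u] by (simp add: line_point_def)
    then have "ereal (line_point \<alpha> \<beta> u) \<le> max (ereal \<alpha>) (ereal \<beta>)"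
      by (simp add: max_def split: if_splits)
    also have "\<dots> \<le> ?F x"
      using \<alpha> \<beta> unfolding True by (rule max.boundedI)
    also have "x = line_point x y u"
      using True by (simp add: line_point_def algebra_simps)
    finally show ?thesis .
  next
    case False
    \<comment> \<open>Strictly between the ends, the glued function agrees with \<open>H\<close> off the interior of \<open>P\<close>.\<close>
    have not_interior: "ereal (line_point \<alpha> \<beta> r) \<le> ?F (line_point x y r)"
      if r: "0 \<le> r" "r \<le> 1" "r = 0 \<or> r = 1 \<or> r \<notin> interior P" for r
    proof -
      consider "r = 0" | "r = 1" | "line_point x y r \<notin> V"
        | "0 < r" "r < 1" "line_point x y r \<in> V" "r \<notin> interior P"
        using r by fastforce
      then show ?thesis
      proof cases
        case 4
        then have "line_point x y r \<in> inner_boundary U V"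
          using line_point_in_inner_boundary[OF False xy] by (simp add: P_def)
        then show ?thesis
          using eq below_H r(1,2) by simp
      qed (use \<alpha> \<beta> below_H r(1,2) in \<open>auto simp: line_point_def\<close>)
    qed
    show ?thesis
    proof (cases "u = 0 \<or> u = 1 \<or> u \<notin> interior P")
      case True
      then show ?thesis
        using not_interior u by blast
    next
      case interior: False
      have closed: "s \<in> P \<and> t \<in> P" if "0 \<le> s" "s < t" "t \<le> 1" "{s<..<t} \<subseteq> P" for s t
      proof -
        have "line_point x y s \<in> U" "line_point x y t \<in> U"
          using that xy line_point_in_closed_segment[of _ x y] by fastforce+
        moreover have "open_seg (line_point x y s) (line_point x y t) \<subseteq> V"
          using that by (auto simp: open_seg_line_point P_def)
        ultimately show ?thesis
          using V by (auto simp: closed_wrt_segments_def P_def)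
      qed
      have "0 < u" "u < 1"
        using interior u by auto
      obtain c where c: "0 \<le> c" "c < u" "{c..u} \<subseteq> P" "c = 0 \<or> c \<notin> interior P"
        using left_end_of_component[of 0 u P] closed interior \<open>0 < u\<close> u by blast
      obtain d where d: "u < d" "d \<le> 1" "{u..d} \<subseteq> P" "d = 1 \<or> d \<notin> interior P"
        using right_end_of_component[of u 1 P] closed interior \<open>u < 1\<close> u by blast
      have cd: "{c..d} \<subseteq> P"
        using c(3) d(3) by (meson atLeastAtMost_iff linear subset_iff)
      define k where "k = (u - c) / (d - c)"
      have k: "0 \<le> k" "k \<le> 1" and uk: "u = line_point c d k"
      proof -
        have "d - c > 0"
          using c d by simp
        then show "0 \<le> k" "k \<le> 1"
          using c d by (auto simp: k_def)
        have "line_point c d k = c + k * (d - c)"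
          by (simp add: line_point_def algebra_simps)
        then show "u = line_point c d k"
          using \<open>d - c > 0\<close> by (simp add: k_def)
      qed
      have in_V: "line_point x y r \<in> V" if "c \<le> r" "r \<le> d" for r
        using cd that by (auto simp: P_def)
      have "ereal (line_point \<alpha> \<beta> c) \<le> G (line_point x y c)"
        using not_interior[of c] c d in_V[of c] by auto
      moreover have "ereal (line_point \<alpha> \<beta> d) \<le> G (line_point x y d)"
        using not_interior[of d] c d in_V[of d] by auto
      moreover have "closed_segment (line_point x y c) (line_point x y d) \<subseteq> V"
        using c d in_V by (auto simp: closed_segment_line_point closed_segment_eq_real_ivl)
      ultimately have "ereal (line_point \<alpha> \<beta> u) \<le> G (line_point x y u)"
        using locally_concave_onD[OF G _ _ _ k] unfolding uk line_point_line_point[symmetric]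
        by blast
      then show ?thesis
        using in_V[of u] c d by simp
    qed
  qed
qed

theorem theorem7p3:
  fixes \<Omega> \<Omega>' :: "'a::real_vector set" and f f' :: "'a \<Rightarrow> ereal"
  assumes "\<Omega>' \<subseteq> \<Omega>"
    and "closed_wrt_segments \<Omega> \<Omega>'"
    and "\<And>x. x \<in> \<Omega>' - inner_boundary \<Omega> \<Omega>' \<Longrightarrow> f' x = f x"
    and "\<And>x. x \<in> inner_boundary \<Omega> \<Omega>' \<Longrightarrow> f' x = min_locally_concave f \<Omega> x"
  shows "\<forall>x\<in>\<Omega>'. min_locally_concave f \<Omega> x = min_locally_concave f' \<Omega>' x"
proof
  fix x assume x: "x \<in> \<Omega>'"
  let ?B = "min_locally_concave f \<Omega>"
  have conc: "locally_concave_on \<Omega>' ?B"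
    using locally_concave_on_min_locally_concave assms(1) by (rule locally_concave_on_subset)
  have f'_le: "f' y \<le> ?B y" if "y \<in> \<Omega>'" for y
  proof (cases "y \<in> inner_boundary \<Omega> \<Omega>'")
    case False
    then show ?thesis
      using that assms(1,3) min_locally_concave_ge[of y \<Omega> f] by auto
  qed (simp add: assms(4))
  have f_le: "f y \<le> f' y" if "y \<in> \<Omega>'" for y
  proof (cases "y \<in> inner_boundary \<Omega> \<Omega>'")
    case True
    then show ?thesis
      using that assms(1,4) min_locally_concave_ge[of y \<Omega> f] by auto
  qed (use that assms(3) in simp)
  have "?B x \<le> min_locally_concave f' \<Omega>' x"
    unfolding min_locally_concave_def[of f']
  proof (rule Inf_greatest, clarify)
    fix G assume G: "locally_concave_on \<Omega>' G" "\<forall>y\<in>\<Omega>'. f' y \<le> G y"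
    define F where "F = (\<lambda>y. if y \<in> \<Omega>' then min (G y) (?B y) else ?B y)"
    have "min (G y) (?B y) = ?B y" if "y \<in> inner_boundary \<Omega> \<Omega>'" for y
      using G(2) assms(4)[OF that] that inner_boundary_subset by (metis min.absorb2 subsetD)
    then have "locally_concave_on \<Omega> F"
      unfolding F_def
      by (intro locally_concave_on_glue assms(2) locally_concave_on_min_locally_concave
          locally_concave_on_min G(1) conc) auto
    moreover have "f y \<le> F y" if "y \<in> \<Omega>" for y
      using that G(2) f_le[of y] min_locally_concave_ge[of y \<Omega> f]
      by (auto simp: F_def intro: order_trans)
    ultimately have "?B x \<le> F x"
      by (rule min_locally_concave_le)
    then show "?B x \<le> G x"
      using x by (simp add: F_def)
  qed
  moreover have "min_locally_concave f' \<Omega>' x \<le> ?B x"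
    using conc f'_le by (rule min_locally_concave_le)
  ultimately show "?B x = min_locally_concave f' \<Omega>' x"
    by (rule antisym)
qed

end
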